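(* There is a universal constant $c_0>0$ such that for all integers $V\ge 1$, $W\ge 2$, $M\ge 1$, when each packet $p$ has work $w(p)\in\{1,\dots,W\}$ and profit $v(p)\in\{1,\dots,V\}$ and at most $M$ unknown packets may arrive in any cycle, the competitive ratio of any randomized online algorithm is at least $c_0\cdot\min\{VW,M\}$; i.e. it is $\Omega(\min\{VW,M\})$.
   Context: Model. Time is divided into discrete cycles, each consisting of three steps: (i) transmission: fully processed packets leave the queue; (ii) arrival: new packets may arrive, and the algorithm decides which of them to accept and which currently buffered packets to push out and drop; (iii) processing: the algorithm schedules a single buffered packet, which receives one processing cycle (processing of a packet may be interrupted and resumed). The buffer holds at most $B$ packets, $B\ge 2$. Packets have unit size; packet $p$ has a profit $v(p)$ (gained when it is transmitted) and a work $w(p)$ (the number of processing cycles it needs before it can be transmitted). On arrival the pair $(w(p),v(p))$ is either known to the algorithm (a $K$-packet) or unknown (a $U$-packet); the characteristics of a $U$-packet become known to the algorithm once the packet undergoes its first processing cycle (which counts as one of its $w(p)$ cycles). $M$ is the maximum number of $U$-packets arriving in a single cycle. The throughput of an algorithm on a finite arrival sequence is the total profit of all packets it eventually transmits. An online algorithm does not know future arrivals; an offline algorithm knows the whole arrival sequence, including the characteristics of all packets. A (randomized) online algorithm is $c$-competitive if for every finite arrival sequence the throughput of any offline algorithm is at most $c$ times the (expected) throughput of the online algorithm; its competitive ratio is the infimum of such $c$. *)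

theory Defs
  imports "HOL-Probability.Probability"
begin

(* An arrival sequence lists the batch of packets arriving in each cycle; there are no arrivals
   after the end of the list. Cycles are numbered from 0, and a packet is identified by its arrival
   cycle together with its position in that cycle's batch. *)

datatype packet = Packet (known: bool) (work: nat) (profit: nat)

type_synonym arrival_seq = "packet list list"
type_synonym packet_id = "nat \<times> nat"

definition batch :: "arrival_seq \<Rightarrow> nat \<Rightarrow> packet list" where
  "batch \<sigma> t = (if t < length \<sigma> then \<sigma> ! t else [])"

definition packet_of :: "arrival_seq \<Rightarrow> packet_id \<Rightarrow> packet" where
  "packet_of \<sigma> p = batch \<sigma> (fst p) ! snd p"

definition arriving :: "arrival_seq \<Rightarrow> nat \<Rightarrow> packet_id set" where
  "arriving \<sigma> t = {(t, j) | j. j < length (batch \<sigma> t)}"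

definition legal_arrivals :: "nat \<Rightarrow> nat \<Rightarrow> nat \<Rightarrow> arrival_seq set" where
  "legal_arrivals V W M =
     {\<sigma>. \<forall>ps \<in> set \<sigma>.
        (\<forall>p \<in> set ps. work p \<in> {1..W} \<and> profit p \<in> {1..V}) \<and>
        length (filter (\<lambda>p. \<not> known p) ps) \<le> M}"

(* The decision in a cycle: the buffer content after the arrival step (everything else is rejected
   or pushed out) and the packet scheduled in the processing step. The scheduled component is
   meaningless when the buffer is empty. *)

datatype decision = Decision (buffer: "packet_id set") (scheduled: packet_id)

definition processed :: "decision \<Rightarrow> packet_id set" where
  "processed D = {scheduled D} \<inter> buffer D"

definition processing_received :: "(nat \<Rightarrow> decision) \<Rightarrow> nat \<Rightarrow> packet_id \<Rightarrow> nat" where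
  "processing_received d t p = card {i. i < t \<and> p \<in> processed (d i)}"

(* The packets present at the start of cycle t are those buffered at the end of cycle t - 1;
   transmission is the first step of the cycle. *)

definition present :: "(nat \<Rightarrow> decision) \<Rightarrow> nat \<Rightarrow> packet_id set" where
  "present d t = (case t of 0 \<Rightarrow> {} | Suc s \<Rightarrow> buffer (d s))"

definition transmitted :: "arrival_seq \<Rightarrow> (nat \<Rightarrow> decision) \<Rightarrow> nat \<Rightarrow> packet_id set" where
  "transmitted \<sigma> d t =
     {p \<in> present d t. work (packet_of \<sigma> p) \<le> processing_received d t p}"

definition feasible :: "nat \<Rightarrow> arrival_seq \<Rightarrow> (nat \<Rightarrow> decision) \<Rightarrow> bool" where
  "feasible B \<sigma> d \<longleftrightarrow>
     (\<forall>t. buffer (d t) \<subseteq> (present d t - transmitted \<sigma> d t) \<union> arriving \<sigma> t \<and>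
          card (buffer (d t)) \<le> B \<and>
          (buffer (d t) \<noteq> {} \<longrightarrow> scheduled (d t) \<in> buffer (d t)))"

definition throughput :: "arrival_seq \<Rightarrow> (nat \<Rightarrow> decision) \<Rightarrow> real" where
  "throughput \<sigma> d =
     (\<Sum>p \<in> (\<Union>t. arriving \<sigma> t) \<inter> (\<Union>t. transmitted \<sigma> d t). real (profit (packet_of \<sigma> p)))"

(* What an algorithm sees of a packet: whether it arrived with known characteristics, and (work, profit)
   if that is already known. The view in cycle t consists of the batches of cycles 0, ..., t, where
   R is the set of packets processed before cycle t. The past views and decisions of a deterministic
   algorithm can be recomputed from its current view, so this is its full information. *)

type_synonym observation = "bool \<times> (nat \<times> nat) option"
type_synonym view = "observation list list"
type_synonym online_alg = "view \<Rightarrow> decision"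

definition observe :: "packet \<Rightarrow> bool \<Rightarrow> observation" where
  "observe p revealed =
     (known p, if known p \<or> revealed then Some (work p, profit p) else None)"

definition view_of :: "arrival_seq \<Rightarrow> packet_id set \<Rightarrow> nat \<Rightarrow> view" where
  "view_of \<sigma> R t =
     map (\<lambda>i. map (\<lambda>j. observe (packet_of \<sigma> (i, j)) ((i, j) \<in> R)) [0..<length (batch \<sigma> i)])
       [0..<Suc t]"

primrec processed_before :: "online_alg \<Rightarrow> arrival_seq \<Rightarrow> nat \<Rightarrow> packet_id set" where
  "processed_before A \<sigma> 0 = {}"
| "processed_before A \<sigma> (Suc t) =
     processed_before A \<sigma> t \<union> processed (A (view_of \<sigma> (processed_before A \<sigma> t) t))"

definition run :: "online_alg \<Rightarrow> arrival_seq \<Rightarrow> nat \<Rightarrow> decision" where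
  "run A \<sigma> t = A (view_of \<sigma> (processed_before A \<sigma> t) t)"

definition deterministic_online :: "nat \<Rightarrow> nat \<Rightarrow> nat \<Rightarrow> nat \<Rightarrow> online_alg \<Rightarrow> bool" where
  "deterministic_online V W M B A \<longleftrightarrow> (\<forall>\<sigma> \<in> legal_arrivals V W M. feasible B \<sigma> (run A \<sigma>))"

(* A randomized algorithm is a probability distribution on deterministic ones. The sigma-algebra is
   arbitrary, subject only to the throughput on each arrival sequence being a random variable. *)

definition randomized_online ::
  "nat \<Rightarrow> nat \<Rightarrow> nat \<Rightarrow> nat \<Rightarrow> online_alg measure \<Rightarrow> bool" where
  "randomized_online V W M B P \<longleftrightarrow>
     prob_space P \<and>
     (\<forall>A \<in> space P. deterministic_online V W M B A) \<and>
     (\<forall>\<sigma> \<in> legal_arrivals V W M. (\<lambda>A. throughput \<sigma> (run A \<sigma>)) \<in> borel_measurable P)"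

definition expected_throughput :: "online_alg measure \<Rightarrow> arrival_seq \<Rightarrow> real" where
  "expected_throughput P \<sigma> = (\<integral>A. throughput \<sigma> (run A \<sigma>) \<partial>P)"

(* On a given arrival sequence an offline algorithm amounts to an arbitrary feasible sequence of
   decisions. *)

definition competitive ::
  "nat \<Rightarrow> nat \<Rightarrow> nat \<Rightarrow> nat \<Rightarrow> online_alg measure \<Rightarrow> real \<Rightarrow> bool" where
  "competitive V W M B P c \<longleftrightarrow>
     (\<forall>\<sigma> \<in> legal_arrivals V W M. \<forall>d. feasible B \<sigma> d \<longrightarrow>
        throughput \<sigma> d \<le> c * expected_throughput P \<sigma>)"

(* Infinite if the algorithm is not c-competitive for any c. *)

definition competitive_ratio ::
  "nat \<Rightarrow> nat \<Rightarrow> nat \<Rightarrow> nat \<Rightarrow> online_alg measure \<Rightarrow> ereal" where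
  "competitive_ratio V W M B P = (INF c \<in> {c. competitive V W M B P c}. ereal c)"

end

theory Submission
  imports Defs
begin

text \<open>Yao's principle. In each of \<open>N\<close> cycles, \<open>M\<close> unknown packets arrive; each is independently
  good (work 1, profit \<open>V\<close>) with probability \<open>1 / M\<close> and bad (work \<open>W\<close>, profit 1) otherwise. A batch
  contains a good packet with probability at least \<open>1 / 2\<close>, so an offline algorithm gains at least
  \<open>N V / 2\<close> in expectation. An online algorithm starts at most \<open>N\<close> packets during these cycles, each
  of them good with probability \<open>1 / M\<close> only, and completes at most \<open>N / W\<close> bad ones; whatever it
  transmits later was in its buffer and is worth at most \<open>B V\<close>. So it gains at most
  \<open>N V / M + N / W + B V\<close> in expectation, and \<open>N = B M\<close> makes the last term equal to the first.\<close>

section \<open>Processed packets and online information\<close>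

lemma processed_before_eq: "processed_before A \<sigma> t = (\<Union>i<t. processed (run A \<sigma> i))"
  by (induction t) (auto simp: run_def lessThan_Suc)

lemma finite_processed: "finite (processed D)"
  by (simp add: processed_def)

lemma card_processed_le: "card (processed D) \<le> 1"
  using card_mono[of "{scheduled D}" "processed D"] by (simp add: processed_def)

lemma card_processed_before_le: "card (processed_before A \<sigma> t) \<le> t"
proof -
  have "card (processed_before A \<sigma> t) \<le> (\<Sum>i<t. card (processed (run A \<sigma> i)))"
    unfolding processed_before_eq by (rule card_UN_le) simp
  also have "\<dots> \<le> (\<Sum>i<t. 1)"
    by (intro sum_mono card_processed_le)
  finally show ?thesis by simp
qed

text \<open>An unknown packet outside \<open>R\<close> is observed as \<open>(False, None)\<close>
  whatever its work and profit, so inputs that differ only in such a packet are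
  indistinguishable.\<close>

lemma view_of_cong:
  assumes "\<And>i. length (batch \<sigma> i) = length (batch \<sigma>' i)"
    and "\<And>q. q \<in> arriving \<sigma> (fst q) \<Longrightarrow> q \<noteq> p \<Longrightarrow> packet_of \<sigma> q = packet_of \<sigma>' q"
    and "\<not> known (packet_of \<sigma> p)" "\<not> known (packet_of \<sigma>' p)" "p \<notin> R"
  shows "view_of \<sigma> R t = view_of \<sigma>' R t"
proof -
  have "observe (packet_of \<sigma> (i, j)) ((i, j) \<in> R) = observe (packet_of \<sigma>' (i, j)) ((i, j) \<in> R)"
    if "j < length (batch \<sigma> i)" for i j
    using assms that by (cases "(i, j) = p") (auto simp: observe_def arriving_def)
  then show ?thesis
    by (auto simp: view_of_def simp flip: assms(1))
qed

lemma processed_before_cong: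
  assumes "\<And>i. length (batch \<sigma> i) = length (batch \<sigma>' i)"
    and "\<And>q. q \<in> arriving \<sigma> (fst q) \<Longrightarrow> q \<noteq> p \<Longrightarrow> packet_of \<sigma> q = packet_of \<sigma>' q"
    and "\<not> known (packet_of \<sigma> p)" "\<not> known (packet_of \<sigma>' p)"
  shows "p \<in> processed_before A \<sigma> t \<longleftrightarrow> p \<in> processed_before A \<sigma>' t"
proof -
  \<comment> \<open>The equivalence alone is not inductive. As long as \<open>p\<close> is
    unprocessed, the two runs have equal views and hence take equal decisions; once both have
    processed \<open>p\<close>, they may diverge and nothing more is claimed.\<close>
  have "p \<in> processed_before A \<sigma> t \<and> p \<in> processed_before A \<sigma>' t \<or>
        p \<notin> processed_before A \<sigma> t \<and> processed_before A \<sigma> t = processed_before A \<sigma>' t"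
  proof (induction t)
    case (Suc t)
    then show ?case
      using view_of_cong[of \<sigma> \<sigma>' p "processed_before A \<sigma> t" t] assms by auto
  qed simp
  then show ?thesis by blast
qed

section \<open>Bounds on the throughput of schedules\<close>

lemma finite_arriving: "finite (arriving \<sigma> t)"
  by (auto simp: arriving_def)

lemma arriving_empty: "length \<sigma> \<le> t \<Longrightarrow> arriving \<sigma> t = {}"
  by (simp add: arriving_def batch_def)

lemma finite_all_arriving: "finite (\<Union>t. arriving \<sigma> t)"
proof -
  have "arriving \<sigma> t \<subseteq> (\<Union>s<length \<sigma>. arriving \<sigma> s)" for t
    using arriving_empty[of \<sigma> t] by (cases "t < length \<sigma>") auto
  then have "(\<Union>t. arriving \<sigma> t) \<subseteq> (\<Union>s<length \<sigma>. arriving \<sigma> s)"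
    by blast
  then show ?thesis
    by (rule finite_subset) (simp add: finite_arriving)
qed

lemma throughput_nonneg: "throughput \<sigma> d \<ge> 0"
  by (simp add: throughput_def sum_nonneg)

lemma throughput_le_total:
  "throughput \<sigma> d \<le> (\<Sum>p\<in>(\<Union>t. arriving \<sigma> t). real (profit (packet_of \<sigma> p)))"
  unfolding throughput_def by (intro sum_mono2 finite_all_arriving) auto

lemma processing_received_mono: "s \<le> t \<Longrightarrow> processing_received d s p \<le> processing_received d t p"
  unfolding processing_received_def by (rule card_mono) auto

lemma buffer_subset_arrived:
  assumes "feasible B \<sigma> d"
  shows "buffer (d t) \<subseteq> (\<Union>t. arriving \<sigma> t)"
proof (induction t)
  case 0
  then show ?case
    using assms[unfolded feasible_def, rule_format, of 0] by (auto simp: present_def)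
next
  case (Suc t)
  then show ?case
    using assms[unfolded feasible_def, rule_format, of "Suc t"] by (auto simp: present_def)
qed

lemma buffer_decreasing_after_arrivals:
  assumes "feasible B \<sigma> d" "length \<sigma> \<le> s" "s \<le> t"
  shows "buffer (d t) \<subseteq> buffer (d s)"
  using assms(3)
proof (induction t rule: dec_induct)
  case (step n)
  then show ?case
    using assms(1)[unfolded feasible_def, rule_format, of "Suc n"] assms(2)
      arriving_empty[of \<sigma> "Suc n"] by (auto simp: present_def)
qed simp

text \<open>Double counting: each of the first \<open>t\<close> cycles gives processing to at most
  one packet.\<close>

lemma sum_processing_received_le:
  assumes "finite S"
  shows "(\<Sum>p\<in>S. processing_received d t p) \<le> t"
proof -
  have "(\<Sum>p\<in>S. processing_received d t p)
      = (\<Sum>p\<in>S. \<Sum>i<t. if p \<in> processed (d i) then 1 else 0)"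
    unfolding processing_received_def
    by (intro sum.cong refl) (simp add: sum.If_cases Int_def)
  also have "\<dots> = (\<Sum>i<t. \<Sum>p\<in>S. if p \<in> processed (d i) then 1 else 0)"
    by (rule sum.swap)
  also have "\<dots> = (\<Sum>i<t. card (S \<inter> processed (d i)))"
    using assms by (intro sum.cong refl) (simp add: sum.If_cases)
  also have "\<dots> \<le> (\<Sum>i<t. 1)"
  proof (rule sum_mono)
    fix i
    show "card (S \<inter> processed (d i)) \<le> 1"
      using card_mono[OF finite_processed[of "d i"], of "S \<inter> processed (d i)"]
        card_processed_le[of "d i"] by simp
  qed
  finally show ?thesis by simp
qed

text \<open>Transmissions are split at cycle \<open>length \<sigma>\<close>. Up to then, a
  transmitted good packet has been processed, and each transmitted bad one has used \<open>W\<close>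
  of the available processing cycles. Anything transmitted later was still buffered when arrivals
  had ended, which costs at most \<open>B\<close> packets of profit at most
  \<open>V\<close>.\<close>

lemma throughput_le:
  assumes feas: "feasible B \<sigma> d" and W: "W \<ge> 1" and V: "V \<ge> 1"
    and good: "\<And>p. p \<in> G \<Longrightarrow> work (packet_of \<sigma> p) = 1 \<and> profit (packet_of \<sigma> p) = V"
    and bad: "\<And>p. p \<in> (\<Union>t. arriving \<sigma> t) - G \<Longrightarrow>
                work (packet_of \<sigma> p) = W \<and> profit (packet_of \<sigma> p) = 1"
    and G: "G \<subseteq> (\<Union>t. arriving \<sigma> t)"
  shows "throughput \<sigma> d
     \<le> real V * real (card (G \<inter> (\<Union>i<length \<sigma>. processed (d i)))) + real (length \<sigma>) / real W
       + real B * real V"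
proof -
  define N where "N = length \<sigma>"
  define I where "I = (\<Union>t. arriving \<sigma> t)"
  define X where "X = G \<inter> (\<Union>i<N. processed (d i))"
  define L where "L = {p \<in> I - G. W \<le> processing_received d N p}"
  define Y where "Y = buffer (d N)"
  let ?v = "\<lambda>p. real (profit (packet_of \<sigma> p))"
  have I: "finite I" unfolding I_def by (rule finite_all_arriving)
  have Y: "Y \<subseteq> I" unfolding Y_def I_def by (rule buffer_subset_arrived[OF feas])
  have fin: "finite X" "finite L" "finite Y"
    using Y G by (auto intro: finite_subset[OF _ I] simp: X_def L_def simp flip: I_def)
  have v: "?v p \<le> real V" if "p \<in> I" for p
    using good[of p] bad[of p] that V by (cases "p \<in> G") (auto simp: I_def)
  have sub: "I \<inter> (\<Union>t. transmitted \<sigma> d t) \<subseteq> X \<union> L \<union> Y"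
  proof
    fix p assume "p \<in> I \<inter> (\<Union>t. transmitted \<sigma> d t)"
    then obtain t where pI: "p \<in> I" and p: "p \<in> present d t"
      and w: "work (packet_of \<sigma> p) \<le> processing_received d t p"
      by (auto simp: transmitted_def)
    show "p \<in> X \<union> L \<union> Y"
    proof (cases "t \<le> N")
      case True
      have w': "work (packet_of \<sigma> p) \<le> processing_received d N p"
        using w processing_received_mono[OF True, of d p] by simp
      show ?thesis
      proof (cases "p \<in> G")
        case True
        then have "processing_received d N p \<noteq> 0" using good[of p] w' by simp
        then have "{i. i < N \<and> p \<in> processed (d i)} \<noteq> {}"
          unfolding processing_received_def by (metis card.empty)
        then show ?thesis using True by (auto simp: X_def)
      next
        case False
        then show ?thesis using bad[of p] w' pI by (simp add: L_def I_def)
      qed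
    next
      case False
      \<comment> \<open>Transmission in cycle \<open>t\<close> takes packets from the buffer of
        cycle \<open>t - 1\<close>, so \<open>t > N\<close> leads back to the buffer of a cycle
        \<open>s \<ge> N\<close>, which lies inside \<open>buffer (d N)\<close>.\<close>
      then obtain s where "t = Suc s" "N \<le> s" by (cases t) auto
      then show ?thesis
        using p buffer_decreasing_after_arrivals[OF feas, of N s]
        by (auto simp: present_def Y_def N_def)
    qed
  qed
  have "throughput \<sigma> d \<le> sum ?v (X \<union> L \<union> Y)"
    unfolding throughput_def using sub fin by (intro sum_mono2) (auto simp: I_def)
  \<comment> \<open>The three sets may overlap; since profits are nonnegative, counting a packet
    twice only weakens the bound.\<close>
  also have "\<dots> \<le> sum ?v (X \<union> L) + sum ?v Y"
    using sum.union_inter[of "X \<union> L" Y ?v] fin sum_nonneg[of "(X \<union> L) \<inter> Y" ?v] by simp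
  also have "sum ?v (X \<union> L) \<le> sum ?v X + sum ?v L"
    using sum.union_inter[of X L ?v] fin sum_nonneg[of "X \<inter> L" ?v] by simp
  also have "sum ?v X = real V * real (card X)"
    using good by (simp add: X_def)
  also have "sum ?v L = real (card L)"
    using bad by (simp add: L_def I_def)
  also have "sum ?v Y \<le> real (card Y) * real V"
    using sum_bounded_above[of Y ?v "real V"] v Y by auto
  also have "\<dots> \<le> real B * real V"
    using feas by (intro mult_right_mono) (auto simp: feasible_def Y_def)
  also have "real (card L) \<le> real N / real W"
  proof -
    have "card L * W \<le> (\<Sum>p\<in>L. processing_received d N p)"
      using sum_bounded_below[of L W "processing_received d N"] by (auto simp: L_def)
    also have "\<dots> \<le> N" using fin(2) by (rule sum_processing_received_le)
    finally show ?thesis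
      using W by (simp add: pos_le_divide_eq flip: of_nat_mult)
  qed
  finally show ?thesis by (simp add: X_def N_def)
qed

text \<open>An offline algorithm that only ever accepts packets of work 1, one per cycle, and transmits
  each of them in the following cycle.\<close>

lemma throughput_greedy_unit_work:
  assumes "B \<ge> 1"
    and f: "\<And>t. t \<in> S \<Longrightarrow> (t, f t) \<in> arriving \<sigma> t \<and> work (packet_of \<sigma> (t, f t)) = 1
                          \<and> profit (packet_of \<sigma> (t, f t)) = V"
  obtains d where "feasible B \<sigma> d" "real V * real (card S) \<le> throughput \<sigma> d"
proof
  \<comment> \<open>Outside \<open>S\<close> the buffer is empty and the scheduled component is a
    dummy. The packet accepted in cycle \<open>t\<close> is absent from the next buffer because it
    is transmitted at the start of cycle \<open>Suc t\<close>.\<close>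
  define d where "d t = Decision (if t \<in> S then {(t, f t)} else {}) (t, f t)" for t
  show "feasible B \<sigma> d"
  proof -
    have "buffer (d t) \<subseteq> (present d t - transmitted \<sigma> d t) \<union> arriving \<sigma> t" for t
      using f by (auto simp: d_def)
    then show ?thesis using assms(1) by (auto simp: feasible_def d_def)
  qed
  have tr: "(t, f t) \<in> transmitted \<sigma> d (Suc t)" if "t \<in> S" for t
  proof -
    have "card {t} \<le> processing_received d (Suc t) (t, f t)"
      unfolding processing_received_def
      by (rule card_mono) (use that in \<open>auto simp: d_def processed_def\<close>)
    then show ?thesis using f[OF that] that by (simp add: transmitted_def present_def d_def)
  qed
  have inj: "inj_on (\<lambda>t. (t, f t)) S" by (auto simp: inj_on_def)
  have "real V * real (card S) = (\<Sum>p\<in>(\<lambda>t. (t, f t)) ` S. real (profit (packet_of \<sigma> p)))"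
    by (simp add: sum.reindex[OF inj] f)
  also have "\<dots> \<le> throughput \<sigma> d"
    unfolding throughput_def using finite_all_arriving[of \<sigma>] f tr by (intro sum_mono2) auto
  finally show "real V * real (card S) \<le> throughput \<sigma> d" .
qed

section \<open>Random labelled inputs and the online gain\<close>

text \<open>All nonzero labels give the same bad packet; having several of them turns probability
  \<open>1 / M\<close> into uniform counting over \<open>M\<close> labels.\<close>

definition labelled_packet :: "nat \<Rightarrow> nat \<Rightarrow> nat \<Rightarrow> packet" where
  "labelled_packet V W l = (if l = 0 then Packet False 1 V else Packet False W 1)"

definition labelled_seq :: "nat \<Rightarrow> nat \<Rightarrow> nat \<Rightarrow> nat \<Rightarrow> (packet_id \<Rightarrow> nat) \<Rightarrow> arrival_seq" where
  "labelled_seq V W N M \<xi> = map (\<lambda>i. map (\<lambda>j. labelled_packet V W (\<xi> (i, j))) [0..<M]) [0..<N]"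

text \<open>A uniformly distributed element of this set makes the packets independently good, i.e. of
  label 0, with probability \<open>1 / M\<close> each.\<close>

definition labellings :: "nat \<Rightarrow> nat \<Rightarrow> (packet_id \<Rightarrow> nat) set" where
  "labellings N M = ({..<N} \<times> {..<M}) \<rightarrow>\<^sub>E {..<M}"

lemma finite_labellings: "finite (labellings N M)"
  by (simp add: labellings_def finite_PiE)

lemma length_labelled_seq [simp]: "length (labelled_seq V W N M \<xi>) = N"
  by (simp add: labelled_seq_def)

lemma batch_labelled_seq:
  "batch (labelled_seq V W N M \<xi>) i
     = (if i < N then map (\<lambda>j. labelled_packet V W (\<xi> (i, j))) [0..<M] else [])"
  by (simp add: batch_def) (simp add: labelled_seq_def)

lemma arriving_labelled_seq:
  "arriving (labelled_seq V W N M \<xi>) i = (if i < N then {i} \<times> {..<M} else {})"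
  by (auto simp: arriving_def batch_labelled_seq)

lemma all_arriving_labelled_seq:
  "(\<Union>i. arriving (labelled_seq V W N M \<xi>) i) = {..<N} \<times> {..<M}"
  by (auto simp: arriving_labelled_seq)

lemma packet_of_labelled_seq:
  "p \<in> {..<N} \<times> {..<M} \<Longrightarrow> packet_of (labelled_seq V W N M \<xi>) p = labelled_packet V W (\<xi> p)"
  by (auto simp: packet_of_def batch_labelled_seq)

lemma labelled_seq_legal:
  assumes "V \<ge> 1" "W \<ge> 1"
  shows "labelled_seq V W N M \<xi> \<in> legal_arrivals V W M"
proof -
  have "length (filter P (map g [0..<M])) \<le> M" for P and g :: "nat \<Rightarrow> packet"
    using length_filter_le[of P "map g [0..<M]"] by simp
  then show ?thesis
    using assms by (auto simp: legal_arrivals_def labelled_seq_def labelled_packet_def)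
qed

text \<open>Whether a packet is ever processed before time \<open>t\<close> does not depend on its own label, which
  is invisible until then.\<close>

lemma card_processed_good_le:
  assumes p: "p \<in> {..<N} \<times> {..<M}"
  shows "card {\<xi> \<in> labellings N M. \<xi> p = 0 \<and> p \<in> processed_before A (labelled_seq V W N M \<xi>) t} * M
       \<le> card {\<xi> \<in> labellings N M. p \<in> processed_before A (labelled_seq V W N M \<xi>) t}"
    (is "card ?S * M \<le> card ?T")
proof -
  have inv: "p \<in> processed_before A (labelled_seq V W N M (\<xi>(p := k))) t
         \<longleftrightarrow> p \<in> processed_before A (labelled_seq V W N M \<xi>) t" for \<xi> k
    by (rule processed_before_cong)
       (use p in \<open>auto simp: batch_labelled_seq arriving_labelled_seq packet_of_labelled_seq
          labelled_packet_def split: if_splits\<close>)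
  \<comment> \<open>Counting form of independence: relabelling \<open>p\<close> arbitrarily turns
    each member of \<open>?S\<close> into \<open>M\<close> labellings that still process
    \<open>p\<close>. The original is recovered by resetting the label of \<open>p\<close> to
    0.\<close>
  have "card (?S \<times> {..<M}) \<le> card ?T"
  proof (rule card_inj_on_le)
    show "inj_on (\<lambda>(\<xi>, k). \<xi>(p := k)) (?S \<times> {..<M})"
    proof (rule inj_onI, clarify)
      fix \<xi> k \<xi>' k'
      assume eq: "\<xi>(p := k) = \<xi>'(p := k')" and "\<xi> p = 0" "\<xi>' p = 0"
      have "\<xi> q = \<xi>' q" for q
        using fun_cong[OF eq, of q] \<open>\<xi> p = 0\<close> \<open>\<xi>' p = 0\<close> by (cases "q = p") auto
      then show "\<xi> = \<xi>' \<and> k = k'" using fun_cong[OF eq, of p] by auto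
    qed
    show "(\<lambda>(\<xi>, k). \<xi>(p := k)) ` (?S \<times> {..<M}) \<subseteq> ?T"
      using p inv by (auto simp: labellings_def PiE_iff extensional_def)
    show "finite ?T" using finite_labellings by simp
  qed
  then show ?thesis by (simp add: card_cartesian_product)
qed

lemma sum_card_filter_swap:
  assumes "finite X" "finite Y"
  shows "(\<Sum>x\<in>X. card {y \<in> Y. R x y}) = (\<Sum>y\<in>Y. card {x \<in> X. R x y})"
  using assms sum_multicount_gen[of X Y R "\<lambda>y. card {x \<in> X. R x y}"] by simp

text \<open>\<open>throughput_le\<close> is summed over all labellings for one fixed deterministic
  algorithm. What remains is the average number of good packets processed in the first
  \<open>N\<close> cycles, which is at most \<open>N / M\<close>.\<close>

lemma sum_throughput_online_le:
  assumes A: "deterministic_online V W M B A" and V: "V \<ge> 1" and W: "W \<ge> 1" and M: "M \<ge> 1"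
  shows "(\<Sum>\<xi>\<in>labellings N M. throughput (labelled_seq V W N M \<xi>) (run A (labelled_seq V W N M \<xi>)))
    \<le> real (card (labellings N M)) *
      (real V * real N / real M + real N / real W + real B * real V)"
proof -
  let ?\<sigma> = "labelled_seq V W N M" and ?\<Omega> = "labellings N M" and ?I = "{..<N} \<times> {..<M}"
  let ?P = "\<lambda>\<xi>. processed_before A (?\<sigma> \<xi>) N"
  define H where "H \<xi> = {p \<in> ?I. \<xi> p = 0 \<and> p \<in> ?P \<xi>}" for \<xi>
  have single: "throughput (?\<sigma> \<xi>) (run A (?\<sigma> \<xi>))
      \<le> real V * real (card (H \<xi>)) + real N / real W + real B * real V" for \<xi>
  proof -
    have feas: "feasible B (?\<sigma> \<xi>) (run A (?\<sigma> \<xi>))"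
      using A labelled_seq_legal[OF V W] by (simp add: deterministic_online_def)
    have "throughput (?\<sigma> \<xi>) (run A (?\<sigma> \<xi>)) \<le> real V * real (card ({p \<in> ?I. \<xi> p = 0} \<inter>
        (\<Union>i<length (?\<sigma> \<xi>). processed (run A (?\<sigma> \<xi>) i)))) + real (length (?\<sigma> \<xi>)) / real W
        + real B * real V"
      by (rule throughput_le[OF feas W V])
         (auto simp only: all_arriving_labelled_seq packet_of_labelled_seq labelled_packet_def,
           auto simp: packet_of_labelled_seq labelled_packet_def split: if_splits)
    also have "{p \<in> ?I. \<xi> p = 0} \<inter> (\<Union>i<length (?\<sigma> \<xi>). processed (run A (?\<sigma> \<xi>) i)) = H \<xi>"
      by (auto simp: H_def processed_before_eq)
    finally show ?thesis by simp
  qed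
  \<comment> \<open>The sum is exchanged to run over packets, where
    \<open>card_processed_good_le\<close> trades goodness for a factor \<open>M\<close>, and is then
    exchanged back, where at most \<open>N\<close> packets can have been processed.\<close>
  have "(\<Sum>\<xi>\<in>?\<Omega>. card (H \<xi>)) * M = (\<Sum>p\<in>?I. card {\<xi> \<in> ?\<Omega>. \<xi> p = 0 \<and> p \<in> ?P \<xi>} * M)"
    unfolding H_def
    using sum_card_filter_swap[of ?\<Omega> ?I "\<lambda>\<xi> p. \<xi> p = 0 \<and> p \<in> ?P \<xi>"]
    by (simp add: finite_labellings flip: sum_distrib_right)
  also have "\<dots> \<le> (\<Sum>p\<in>?I. card {\<xi> \<in> ?\<Omega>. p \<in> ?P \<xi>})"
    by (intro sum_mono card_processed_good_le)
  also have "\<dots> = (\<Sum>\<xi>\<in>?\<Omega>. card {p \<in> ?I. p \<in> ?P \<xi>})"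
    using sum_card_filter_swap[of ?\<Omega> ?I "\<lambda>\<xi> p. p \<in> ?P \<xi>"]
    by (simp add: finite_labellings)
  also have "\<dots> \<le> (\<Sum>\<xi>\<in>?\<Omega>. N)"
  proof (rule sum_mono)
    fix \<xi>
    have "finite (?P \<xi>)"
      by (simp add: processed_before_eq finite_processed)
    then have "card {p \<in> ?I. p \<in> ?P \<xi>} \<le> card (?P \<xi>)"
      by (rule card_mono) auto
    then show "card {p \<in> ?I. p \<in> ?P \<xi>} \<le> N"
      using card_processed_before_le[of A "?\<sigma> \<xi>" N] by linarith
  qed
  finally have "(\<Sum>\<xi>\<in>?\<Omega>. card (H \<xi>)) * M \<le> card ?\<Omega> * N" by simp
  then have "real ((\<Sum>\<xi>\<in>?\<Omega>. card (H \<xi>)) * M) \<le> real (card ?\<Omega> * N)"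
    using of_nat_mono by blast
  then have H: "(\<Sum>\<xi>\<in>?\<Omega>. real (card (H \<xi>))) \<le> real (card ?\<Omega>) * real N / real M"
    using M by (simp add: pos_le_divide_eq)
  have "(\<Sum>\<xi>\<in>?\<Omega>. throughput (?\<sigma> \<xi>) (run A (?\<sigma> \<xi>)))
      \<le> (\<Sum>\<xi>\<in>?\<Omega>. real V * real (card (H \<xi>)) + (real N / real W + real B * real V))"
    using single by (intro sum_mono) (simp add: add.assoc)
  also have "\<dots> = real V * (\<Sum>\<xi>\<in>?\<Omega>. real (card (H \<xi>)))
      + real (card ?\<Omega>) * (real N / real W + real B * real V)"
    by (simp add: sum.distrib sum_distrib_left)
  also have "\<dots> \<le> real V * (real (card ?\<Omega>) * real N / real M)
      + real (card ?\<Omega>) * (real N / real W + real B * real V)"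
    using H by (intro add_right_mono mult_left_mono) auto
  finally show ?thesis by (simp add: algebra_simps)
qed

section \<open>Batches with a good packet and the offline gain\<close>

text \<open>This is \<open>(1 - 1 / M) ^ M \<le> 1 / 2\<close> without division. Bernoulli's
  inequality with \<open>x = 1 / (M - 1)\<close> gives
  \<open>(1 + x) ^ M \<ge> 1 + M * x \<ge> 2\<close>; the case \<open>M = 1\<close>, where
  \<open>x\<close> would divide by zero, is separate.\<close>

lemma two_mult_pred_power_le: "M \<ge> 1 \<Longrightarrow> 2 * (M - 1) ^ M \<le> M ^ M" for M :: nat
proof (cases "M = 1")
  case False
  assume "M \<ge> 1"
  define x where "x = 1 / real (M - 1)"
  have M: "real (M - 1) > 0" using False \<open>M \<ge> 1\<close> by simp
  have "2 \<le> 1 + real M * x"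
    using M by (simp add: x_def field_simps)
  also have "\<dots> \<le> (1 + x) ^ M"
    using M by (intro Bernoulli_inequality) (simp add: x_def order_trans[of _ 0])
  finally have "2 * real (M - 1) ^ M \<le> ((1 + x) * real (M - 1)) ^ M"
    using M by (simp add: power_mult_distrib)
  also have "(1 + x) * real (M - 1) = real M"
    using M \<open>M \<ge> 1\<close> by (simp add: x_def field_simps)
  finally have "real (2 * (M - 1) ^ M) \<le> real (M ^ M)" by simp
  then show ?thesis using of_nat_le_iff by blast
qed simp

text \<open>A batch has no good packet with probability \<open>(1 - 1 / M) ^ M\<close>, which is at
  most one half.\<close>

lemma card_good_batch:
  assumes "M \<ge> 1" "i < N"
  shows "card (labellings N M) \<le> 2 * card {\<xi> \<in> labellings N M. \<exists>j<M. \<xi> (i, j) = 0}"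
proof -
  define bad where "bad = {\<xi> \<in> labellings N M. \<forall>j<M. \<xi> (i, j) \<noteq> 0}"
  \<comment> \<open>Excluding label 0 in batch \<open>i\<close> leaves a product set, so its
    cardinality is a product in which only the factors of batch \<open>i\<close> drop from
    \<open>M\<close> to \<open>M - 1\<close>.\<close>
  have "bad = Pi\<^sub>E ({..<N} \<times> {..<M}) (\<lambda>p. if fst p = i then {1..<M} else {..<M})"
  proof (intro set_eqI iffI)
    fix \<xi> assume "\<xi> \<in> bad"
    then show "\<xi> \<in> Pi\<^sub>E ({..<N} \<times> {..<M}) (\<lambda>p. if fst p = i then {1..<M} else {..<M})"
      by (auto simp: bad_def labellings_def PiE_iff Suc_le_eq)
  next
    fix \<xi> assume "\<xi> \<in> Pi\<^sub>E ({..<N} \<times> {..<M}) (\<lambda>p. if fst p = i then {1..<M} else {..<M})"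
    then have *: "\<xi> \<in> extensional ({..<N} \<times> {..<M})"
      "\<And>a b. a < N \<Longrightarrow> b < M \<Longrightarrow> \<xi> (a, b) \<in> (if a = i then {1..<M} else {..<M})"
      by (auto simp: PiE_iff)
    then have "\<xi> (a, b) < M" if "a < N" "b < M" for a b
      using *(2)[OF that] by (simp split: if_splits)
    moreover have "\<xi> (i, j) \<noteq> 0" if "j < M" for j
      using *(2)[OF assms(2) that] by simp
    ultimately show "\<xi> \<in> bad"
      using *(1) by (auto simp: bad_def labellings_def PiE_iff)
  qed
  then have "card bad = (\<Prod>p\<in>{..<N} \<times> {..<M}. if fst p = i then M - 1 else M)"
    by (simp add: card_PiE if_distrib[of card] cong: if_cong)
  also have "\<dots> = (\<Prod>a<N. \<Prod>b<M. if a = i then M - 1 else M)"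
    unfolding prod.cartesian_product by (simp add: case_prod_beta)
  also have "\<dots> = (\<Prod>a<N. if a = i then (M - 1) ^ M else M ^ M)"
    by (intro prod.cong) auto
  also have "\<dots> = (M - 1) ^ M * (\<Prod>a\<in>{..<N} - {i}. M ^ M)"
    using assms(2) by (subst prod.remove[of _ i]) (auto intro!: prod.cong)
  finally have "2 * card bad \<le> M ^ M * (\<Prod>a\<in>{..<N} - {i}. M ^ M)"
    using mult_right_mono[OF two_mult_pred_power_le[OF assms(1)],
        of "\<Prod>a\<in>{..<N} - {i}. M ^ M"]
    by (simp only: mult.assoc le0)
  also have "\<dots> = (\<Prod>a<N. M ^ M)"
    using assms(2) by (subst prod.remove[of _ i]) auto
  also have "\<dots> = card (labellings N M)"
    by (simp add: labellings_def card_PiE power_mult[symmetric] mult.commute)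
  finally have "2 * card bad \<le> card (labellings N M)" .
  moreover have "card (labellings N M)
      = card bad + card {\<xi> \<in> labellings N M. \<exists>j<M. \<xi> (i, j) = 0}"
    by (subst card_Un_disjoint[symmetric])
       (auto simp: bad_def finite_labellings intro: arg_cong[of _ _ card])
  ultimately show ?thesis by simp
qed

text \<open>Knowing the labels, the schedule picks one good packet from every batch that has
  one.\<close>

lemma offline_labelled_seq:
  assumes "B \<ge> 1"
  obtains d where "feasible B (labelled_seq V W N M \<xi>) d"
    "real V * real (card {i \<in> {..<N}. \<exists>j<M. \<xi> (i, j) = 0})
       \<le> throughput (labelled_seq V W N M \<xi>) d"
proof -
  define S where "S = {i \<in> {..<N}. \<exists>j<M. \<xi> (i, j) = 0}"
  have "\<forall>i\<in>S. \<exists>j. j < M \<and> \<xi> (i, j) = 0" by (auto simp: S_def)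
  then obtain f where f: "\<forall>i\<in>S. f i < M \<and> \<xi> (i, f i) = 0" by metis
  show thesis
  proof (rule throughput_greedy_unit_work[OF assms, of S f "labelled_seq V W N M \<xi>" V])
    fix t assume t: "t \<in> S"
    then have "(t, f t) \<in> {..<N} \<times> {..<M}" using f by (auto simp: S_def)
    then show "(t, f t) \<in> arriving (labelled_seq V W N M \<xi>) t \<and>
        work (packet_of (labelled_seq V W N M \<xi>) (t, f t)) = 1 \<and>
        profit (packet_of (labelled_seq V W N M \<xi>) (t, f t)) = V"
      using f t by (simp add: arriving_labelled_seq packet_of_labelled_seq labelled_packet_def)
  qed (use that in \<open>auto simp: S_def\<close>)
qed

text \<open>Linearity of expectation: each of the \<open>N\<close> batches contains a good packet
  for at least half of the labellings.\<close>

lemma sum_card_good_batches_ge: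
  assumes "M \<ge> 1"
  shows "real (card (labellings N M)) * real N / 2
       \<le> (\<Sum>\<xi>\<in>labellings N M. real (card {i \<in> {..<N}. \<exists>j<M. \<xi> (i, j) = 0}))"
proof -
  let ?\<Omega> = "labellings N M"
  have "card ?\<Omega> * N = (\<Sum>i<N. card ?\<Omega>)" by simp
  also have "\<dots> \<le> (\<Sum>i<N. 2 * card {\<xi> \<in> ?\<Omega>. \<exists>j<M. \<xi> (i, j) = 0})"
    using assms by (intro sum_mono card_good_batch) auto
  also have "\<dots> = 2 * (\<Sum>\<xi>\<in>?\<Omega>. card {i \<in> {..<N}. \<exists>j<M. \<xi> (i, j) = 0})"
    using sum_card_filter_swap[of "{..<N}" ?\<Omega> "\<lambda>i \<xi>. \<exists>j<M. \<xi> (i, j) = 0"]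
    by (simp add: finite_labellings flip: sum_distrib_left)
  finally have "real (card ?\<Omega> * N)
      \<le> real (2 * (\<Sum>\<xi>\<in>?\<Omega>. card {i \<in> {..<N}. \<exists>j<M. \<xi> (i, j) = 0}))"
    using of_nat_mono by blast
  then show ?thesis by simp
qed

section \<open>Yao's principle and the competitive ratio\<close>

text \<open>The finite sum over labellings commutes with the expectation over \<open>P\<close>, and
  the bound for deterministic algorithms applies to every point of \<open>space P\<close>.\<close>

lemma sum_expected_throughput_le:
  assumes P: "randomized_online V W M B P" and V: "V \<ge> 1" and W: "W \<ge> 1" and M: "M \<ge> 1"
  shows "(\<Sum>\<xi>\<in>labellings N M. expected_throughput P (labelled_seq V W N M \<xi>))
    \<le> real (card (labellings N M)) *
      (real V * real N / real M + real N / real W + real B * real V)"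
proof -
  interpret prob_space P using P by (simp add: randomized_online_def)
  let ?\<sigma> = "labelled_seq V W N M" and ?\<Omega> = "labellings N M"
  \<comment> \<open>On a fixed input the total profit of all arrivals bounds the throughput
    uniformly in \<open>A\<close>, and \<open>randomized_online\<close> supplies
    measurability.\<close>
  have int: "integrable P (\<lambda>A. throughput (?\<sigma> \<xi>) (run A (?\<sigma> \<xi>)))" for \<xi>
  proof (rule integrable_const_bound)
    show "AE A in P. norm (throughput (?\<sigma> \<xi>) (run A (?\<sigma> \<xi>)))
        \<le> (\<Sum>p\<in>(\<Union>t. arriving (?\<sigma> \<xi>) t). real (profit (packet_of (?\<sigma> \<xi>) p)))"
      by (intro AE_I2) (simp add: throughput_nonneg throughput_le_total)
    show "(\<lambda>A. throughput (?\<sigma> \<xi>) (run A (?\<sigma> \<xi>))) \<in> borel_measurable P"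
      using P labelled_seq_legal[OF V W] by (simp add: randomized_online_def)
  qed
  have "(\<Sum>\<xi>\<in>?\<Omega>. expected_throughput P (?\<sigma> \<xi>))
      = (\<integral>A. (\<Sum>\<xi>\<in>?\<Omega>. throughput (?\<sigma> \<xi>) (run A (?\<sigma> \<xi>))) \<partial>P)"
    unfolding expected_throughput_def by (subst Bochner_Integration.integral_sum) (auto intro: int)
  also have "\<dots> \<le> real (card ?\<Omega>) *
      (real V * real N / real M + real N / real W + real B * real V)"
  proof (rule integral_le_const)
    show "integrable P (\<lambda>A. \<Sum>\<xi>\<in>?\<Omega>. throughput (?\<sigma> \<xi>) (run A (?\<sigma> \<xi>)))"
      by (intro Bochner_Integration.integrable_sum int)
    show "AE A in P. (\<Sum>\<xi>\<in>?\<Omega>. throughput (?\<sigma> \<xi>) (run A (?\<sigma> \<xi>))) \<le> real (card ?\<Omega>) *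
      (real V * real N / real M + real N / real W + real B * real V)"
      using P by (intro AE_I2 sum_throughput_online_le V W M) (simp add: randomized_online_def)
  qed
  finally show ?thesis .
qed

text \<open>Competitiveness on every labelled input also holds after summing over the labellings,
  where the offline and online bounds can be compared.\<close>

lemma competitive_imp_ge:
  assumes P: "randomized_online V W M B P" and c: "competitive V W M B P c"
    and V: "V \<ge> 1" and W: "W \<ge> 1" and M: "M \<ge> 1" and B: "B \<ge> 1"
  shows "real (min (V * W) M) / 6 \<le> c"
proof -
  define N where "N = B * M"
  let ?\<sigma> = "labelled_seq V W N M" and ?\<Omega> = "labellings N M"
  define K where "K = real (card ?\<Omega>)"
  define m where "m = real (min (V * W) M)"
  have K: "K > 0"
    using M finite_labellings[of N M]
    by (auto simp: K_def card_gt_0_iff labellings_def PiE_eq_empty_iff lessThan_empty_iff)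
  have N: "real N > 0" using B M by (simp add: N_def)
  have m: "m > 0" using V W M by (simp add: m_def)
  have E: "0 \<le> expected_throughput P \<sigma>" for \<sigma>
    by (simp add: expected_throughput_def throughput_nonneg)
  have each: "real V * real (card {i \<in> {..<N}. \<exists>j<M. \<xi> (i, j) = 0})
      \<le> c * expected_throughput P (?\<sigma> \<xi>)" for \<xi>
  proof -
    obtain d where "feasible B (?\<sigma> \<xi>) d"
      "real V * real (card {i \<in> {..<N}. \<exists>j<M. \<xi> (i, j) = 0}) \<le> throughput (?\<sigma> \<xi>) d"
      using offline_labelled_seq[OF B] by blast
    moreover have "throughput (?\<sigma> \<xi>) d \<le> c * expected_throughput P (?\<sigma> \<xi>)"
      using c labelled_seq_legal[OF V W] \<open>feasible B (?\<sigma> \<xi>) d\<close> by (simp add: competitive_def)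
    ultimately show ?thesis by linarith
  qed
  have "real V * (K * real N / 2)
      \<le> real V * (\<Sum>\<xi>\<in>?\<Omega>. real (card {i \<in> {..<N}. \<exists>j<M. \<xi> (i, j) = 0}))"
    unfolding K_def by (intro mult_left_mono sum_card_good_batches_ge M) simp
  also have "\<dots> \<le> c * (\<Sum>\<xi>\<in>?\<Omega>. expected_throughput P (?\<sigma> \<xi>))"
    using each by (simp add: sum_distrib_left sum_mono)
  finally have le: "real V * (K * real N / 2) \<le> c * (\<Sum>\<xi>\<in>?\<Omega>. expected_throughput P (?\<sigma> \<xi>))" .
  \<comment> \<open>No sign of \<open>c\<close> is assumed. It must be positive because the offline
    gain is positive and expected throughputs are nonnegative; this allows the online bound to be
    multiplied by \<open>c\<close>.\<close>
  have "0 < real V * (K * real N / 2)" using K N V by simp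
  then have "0 < c * (\<Sum>\<xi>\<in>?\<Omega>. expected_throughput P (?\<sigma> \<xi>))" using le by linarith
  then have c0: "c > 0"
    using sum_nonneg[of ?\<Omega> "\<lambda>\<xi>. expected_throughput P (?\<sigma> \<xi>)"] E
    by (auto simp: zero_less_mult_iff)
  have "c * (\<Sum>\<xi>\<in>?\<Omega>. expected_throughput P (?\<sigma> \<xi>))
      \<le> c * (K * (real V * real N / real M + real N / real W + real B * real V))"
    unfolding K_def using c0 by (intro mult_left_mono sum_expected_throughput_le P V W M) auto
  also have "real B * real V = real V * real N / real M"
    using M by (simp add: N_def)
  finally have "real V * (K * real N / 2) \<le> c * (K * (real V * real N / real M + real N / real W
      + real V * real N / real M))"
    using le by linarith
  \<comment> \<open>The offline bound is factored out so that it cancels against the left-hand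
    side.\<close>
  also have "\<dots> = real V * (K * real N / 2) * (c * (4 / real M + 2 / (real V * real W)))"
    using V W M by (simp add: field_simps)
  finally have "1 \<le> c * (4 / real M + 2 / (real V * real W))"
    using mult_le_cancel_left_pos[OF \<open>0 < real V * (K * real N / 2)\<close>, of 1] by (simp only: mult_1_right)
  \<comment> \<open>Both \<open>M\<close> and \<open>V * W\<close> are at least \<open>m\<close>, so
    the bracket is at most \<open>6 / m\<close>; this is the origin of the constant
    \<open>1 / 6\<close>.\<close>
  also have "\<dots> \<le> c * (4 / m + 2 / m)"
  proof -
    have "m \<le> real M" "m \<le> real V * real W"
      by (simp_all add: m_def flip: of_nat_mult)
    then show ?thesis
      using m c0 by (intro mult_left_mono add_mono divide_left_mono) auto
  qed
  finally show ?thesis using m by (simp add: field_simps m_def)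
qed

theorem corollary4:
  "\<exists>c\<^sub>0 > (0::real). \<forall>V W M B :: nat. V \<ge> 1 \<longrightarrow> W \<ge> 2 \<longrightarrow> M \<ge> 1 \<longrightarrow> B \<ge> 2 \<longrightarrow>
     (\<forall>P. randomized_online V W M B P \<longrightarrow>
        ereal (c\<^sub>0 * real (min (V * W) M)) \<le> competitive_ratio V W M B P)"
proof (intro exI[of _ "1 / 6"] conjI allI impI)
  fix V W M B :: nat and P
  assume asm: "V \<ge> 1" "W \<ge> 2" "M \<ge> 1" "B \<ge> 2" "randomized_online V W M B P"
  show "ereal (1 / 6 * real (min (V * W) M)) \<le> competitive_ratio V W M B P"
    unfolding competitive_ratio_def
  \<comment> \<open>Bounding every admissible \<open>c\<close> also covers the case of no admissible
    \<open>c\<close>, where the infimum is infinite.\<close>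
  proof (rule INF_greatest)
    fix c assume "c \<in> {c. competitive V W M B P c}"
    then have "real (min (V * W) M) / 6 \<le> c"
      using asm by (intro competitive_imp_ge[of V W M B P]) auto
    then show "ereal (1 / 6 * real (min (V * W) M)) \<le> ereal c" by simp
  qed
qed simp

end
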